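(* Let $s$ be a prime power, $q=s^2$, $n=2$, $V=\mathbb F_q^3$, and $\sigma\in\mathrm{Aut}(\mathbb F_q)$ with $\sigma^2=1$, $\sigma\neq1$ (so $x^\sigma=x^s$). Let $M\in M_3(q)\setminus\{0\}$. Then $c_M$ is a minimum weight codeword of $\mathcal C(\Lambda_\sigma)$ if and only if there exist three linearly independent vectors $\xi_1,\xi_2,\xi_3\in V^*$ and nonzero $\alpha,\beta,\gamma\in\mathbb F_q$ such that $\xi_1M=\alpha\xi_1^\sigma$, $\xi_2M=\beta\xi_2^\sigma$, $\xi_3M=\gamma\xi_3^\sigma$ and $N(\alpha)=N(\beta)=N(\gamma)$, where $N(a)=a^{s+1}$.
   Context: $V$ consists of column vectors, $V^*$ of row vectors; $A^\sigma$ means $\sigma$ applied entrywise. $\Lambda_\sigma=\{[x^\sigma\xi]: x\in V\setminus\{0\},\xi\in V^*\setminus\{0\},\xi x=0\}\subseteq\mathrm{PG}(M_3(q))$ with representatives $X_1,\dots,X_N$; $\mathcal C(\Lambda_\sigma)=\{c_M\}$, $c_M=(\mathrm{Tr}(X_1M),\dots,\mathrm{Tr}(X_NM))$. *)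

theory Defs
  imports "HOL-Analysis.Analysis" "HOL-Number_Theory.Prime_Powers"
begin

definition field_automorphism :: "('a::field \<Rightarrow> 'a) \<Rightarrow> bool" where
  "field_automorphism \<sigma> \<longleftrightarrow>
     bij \<sigma> \<and> \<sigma> 1 = 1 \<and>
     (\<forall>a b. \<sigma> (a + b) = \<sigma> a + \<sigma> b) \<and> (\<forall>a b. \<sigma> (a * b) = \<sigma> a * \<sigma> b)"

text \<open>
  Column vectors (elements of V) and row vectors (elements of the dual space) share the
  type 'a ^ 'n; the side from which a matrix acts tells them apart: \<xi> v* M is the row
  vector \<xi>M.
\<close>

definition twist :: "('a \<Rightarrow> 'a) \<Rightarrow> 'a ^ 'n \<Rightarrow> 'a ^ 'n" where
  "twist \<sigma> x = (\<chi> i. \<sigma> (x $ i))"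

text \<open>The 1 x 1 product \<xi>x of a row and a column.\<close>

definition row_times_col :: "'a::semiring_1 ^ 'n \<Rightarrow> 'a ^ 'n \<Rightarrow> 'a" where
  "row_times_col \<xi> x = (\<Sum>i\<in>UNIV. \<xi> $ i * x $ i)"

text \<open>The square matrix x\<xi>, product of a column and a row.\<close>

definition col_times_row :: "'a::semiring_1 ^ 'n \<Rightarrow> 'a ^ 'n \<Rightarrow> 'a ^ 'n ^ 'n" where
  "col_times_row x \<xi> = (\<chi> i j. x $ i * \<xi> $ j)"

text \<open>
  A point of the projective space of the matrix space is a one-dimensional subspace;
  proj_point X is the one spanned by X, meaningful for X \<noteq> 0.
  (The library operation *s does not rescale matrices by scalars of 'a.)
\<close>

definition proj_point :: "'a::field ^ 'n ^ 'n \<Rightarrow> ('a ^ 'n ^ 'n) set" where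
  "proj_point X = {\<chi> i j. c * X $ i $ j | c. True}"

definition Lambda :: "('a::field \<Rightarrow> 'a) \<Rightarrow> ('a ^ 'n ^ 'n) set set" where
  "Lambda \<sigma> = {proj_point (col_times_row (twist \<sigma> x) \<xi>) | x \<xi>.
                 x \<noteq> 0 \<and> \<xi> \<noteq> 0 \<and> row_times_col \<xi> x = 0}"

text \<open>The list Xs contains exactly one representative of every point in L, in some order.\<close>

definition representatives :: "('a::field ^ 'n ^ 'n) list \<Rightarrow> ('a ^ 'n ^ 'n) set set \<Rightarrow> bool" where
  "representatives Xs L \<longleftrightarrow> distinct (map proj_point Xs) \<and> set (map proj_point Xs) = L"

definition codeword :: "('a::field ^ 'n ^ 'n) list \<Rightarrow> 'a ^ 'n ^ 'n \<Rightarrow> 'a list" where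
  "codeword Xs M = map (\<lambda>X. trace (X ** M)) Xs"

definition code :: "('a::field ^ 'n ^ 'n) list \<Rightarrow> 'a list set" where
  "code Xs = range (codeword Xs)"

definition hamming_weight :: "'a::zero list \<Rightarrow> nat" where
  "hamming_weight c = card {i. i < length c \<and> c ! i \<noteq> 0}"

definition minimum_weight_codeword :: "'a::zero list set \<Rightarrow> 'a list \<Rightarrow> bool" where
  "minimum_weight_codeword C c \<longleftrightarrow>
     c \<in> C \<and> (\<exists>a\<in>set c. a \<noteq> 0) \<and>
     (\<forall>d\<in>C. (\<exists>a\<in>set d. a \<noteq> 0) \<longrightarrow> hamming_weight c \<le> hamming_weight d)"

end

theory Submission
  imports Defs
begin

text \<open>
  A flag (x, \<xi>) contributes a zero to c_M exactly when \<xi>M annihilates x^\<sigma>. For fixed \<xi> this happens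
  for all x in the kernel of \<xi> if \<xi>M is a multiple of \<xi>^\<sigma>, and otherwise for the same number of x
  whatever \<xi> is. So the weight is a decreasing affine function of the number of rows \<xi> with
  \<xi>M \<in> \<langle>\<xi>^\<sigma>\<rangle>, called eigenrows here, and minimum weight means a maximal number of eigenrows.

  If there is a basis of eigenrows with eigenvalues of equal nonzero norm, Hilbert 90 rescales it to
  one with a single eigenvalue, and M has as many eigenrows as the identity: the multiples of the
  vectors over the fixed field, more than q^2 + q of them. Otherwise, if M \<noteq> 0, either the eigenrows
  lie in a plane, or there is a basis of eigenrows in which one eigenvalue has a norm different from
  the other two; then every eigenrow is a multiple of that basis vector or lies in the span of the
  other two. Both cases allow at most q^2 + q eigenrows.
\<close>

section \<open>Eigenrows and linear independence of three vectors\<close>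

definition eigenrows :: "('a::field \<Rightarrow> 'a) \<Rightarrow> 'a ^ 'n ^ 'n \<Rightarrow> ('a ^ 'n) set" where
  "eigenrows \<sigma> M = {\<xi>. \<exists>l. \<xi> v* M = l *s twist \<sigma> \<xi>}"

text \<open>Independence of a triple rather than of a set, so that repeated vectors count as
  dependent; this is why the equivalence with \<open>vec.independent\<close> carries a
  \<open>distinct\<close>.\<close>

definition indep3 :: "'a::field ^ 'n \<Rightarrow> 'a ^ 'n \<Rightarrow> 'a ^ 'n \<Rightarrow> bool" where
  "indep3 u v w \<longleftrightarrow> (\<forall>a b c. a *s u + b *s v + c *s w = 0 \<longrightarrow> a = 0 \<and> b = 0 \<and> c = 0)"

lemma indep3_iff_independent:
  "indep3 u v w \<longleftrightarrow> distinct [u, v, w] \<and> vec.independent {u, v, w}"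
proof
  assume i: "indep3 u v w"
  have d: "distinct [u, v, w]"
    using i[unfolded indep3_def, rule_format, of 1 "-1" 0]
      i[unfolded indep3_def, rule_format, of 1 0 "-1"]
      i[unfolded indep3_def, rule_format, of 0 1 "-1"] by auto
  have "\<not> vec.dependent {u, v, w}"
  proof
    assume "vec.dependent {u, v, w}"
    then obtain f where f: "(\<Sum>x\<in>{u,v,w}. f x *s x) = 0" "f u \<noteq> 0 \<or> f v \<noteq> 0 \<or> f w \<noteq> 0"
      by (subst (asm) vec.dependent_finite) auto
    from f(1) d have "f u *s u + f v *s v + f w *s w = 0" by (simp add: add.assoc)
    with i f(2) show False unfolding indep3_def by blast
  qed
  with d show "distinct [u, v, w] \<and> vec.independent {u, v, w}" by blast
next
  assume a: "distinct [u, v, w] \<and> vec.independent {u, v, w}"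
  show "indep3 u v w" unfolding indep3_def
  proof (intro allI impI)
    fix a b c assume e: "a *s u + b *s v + c *s w = 0"
    define f where "f x = (if x = u then a else if x = v then b else c)" for x
    have f: "f u = a" "f v = b" "f w = c" using a by (auto simp: f_def)
    have "(\<Sum>x\<in>{u,v,w}. f x *s x) = 0" using a e f by (simp add: add.assoc)
    moreover have "(\<forall>x\<in>{u,v,w}. f x = 0)"
      using vec.independentD[of "{u,v,w}" "{u,v,w}" f] a calculation by blast
    ultimately show "a = 0 \<and> b = 0 \<and> c = 0" using f by auto
  qed
qed

lemma indep3_rotate: "indep3 u v w \<Longrightarrow> indep3 v w u"
  unfolding indep3_def
proof (intro allI impI)
  fix a b c assume i: "\<forall>a b c. a *s u + b *s v + c *s w = 0 \<longrightarrow> a = 0 \<and> b = 0 \<and> c = 0"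
    and "a *s v + b *s w + c *s u = 0"
  then have "c *s u + a *s v + b *s w = 0" by (simp only: ac_simps)
  then show "a = 0 \<and> b = 0 \<and> c = 0" using i by blast
qed

text \<open>In a nontrivial relation, the last vector with a nonzero coefficient would be a
  combination of the earlier ones.\<close>

lemma indep3_extend:
  assumes "u \<noteq> 0" "\<And>c. v \<noteq> c *s u" "\<And>a b. w \<noteq> a *s u + b *s v"
  shows "indep3 u v w"
  unfolding indep3_def
proof (intro allI impI)
  fix a b c assume e: "a *s u + b *s v + c *s w = 0"
  have c: "c = 0"
  proof (rule ccontr)
    assume "c \<noteq> 0"
    have "w = (1/c) *s (c *s w)" using \<open>c \<noteq> 0\<close> by simp
    also have "c *s w = - (a *s u + b *s v)"
      using e unfolding eq_neg_iff_add_eq_0 by (simp only: add.commute)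
    also have "(1/c) *s \<dots> = (-a/c) *s u + (-b/c) *s v"
      by (simp add: vec_eq_iff field_simps)
    finally show False using assms(3) by blast
  qed
  have b: "b = 0"
  proof (rule ccontr)
    assume "b \<noteq> 0"
    have "v = (1/b) *s (b *s v)" using \<open>b \<noteq> 0\<close> by simp
    also have "b *s v = - (a *s u)"
      using e c unfolding eq_neg_iff_add_eq_0 by (simp add: add.commute)
    also have "(1/b) *s \<dots> = (-a/b) *s u" by (simp add: vec_eq_iff)
    finally show False using assms(2) by blast
  qed
  show "a = 0 \<and> b = 0 \<and> c = 0" using e b c assms(1) by simp
qed

lemma indep3_coefficients_eq:
  assumes "indep3 u v w" "a *s u + b *s v + c *s w = a' *s u + b' *s v + c' *s w"
  shows "a = a' \<and> b = b' \<and> c = c'"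
proof -
  have "(a - a') *s u + (b - b') *s v + (c - c') *s w = 0"
    using assms(2) by (simp add: vec_eq_iff algebra_simps)
  with assms(1) have "a - a' = 0 \<and> b - b' = 0 \<and> c - c' = 0" unfolding indep3_def by blast
  then show ?thesis by simp
qed

text \<open>Counting replaces dimension theory: independence makes the map injective, and both sides
  have q^3 elements.\<close>

lemma indep3_bij:
  fixes u v w :: "'a::{field,finite} ^ 3"
  assumes "indep3 u v w"
  shows "bij (\<lambda>(a, b, c). a *s u + b *s v + c *s w)"
proof -
  let ?f = "\<lambda>(a, b, c). a *s u + b *s v + c *s w"
  have "inj ?f"
    by (rule injI) (auto dest: indep3_coefficients_eq[OF assms])
  moreover have "CARD('a \<times> 'a \<times> 'a) = CARD('a ^ 3)"
    by (simp add: power3_eq_cube)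
  ultimately have "range ?f = UNIV"
    by (intro card_subset_eq) (auto simp: card_image)
  with \<open>inj ?f\<close> show ?thesis by (simp add: bij_def)
qed

lemma indep3_expand:
  fixes u v w :: "'a::{field,finite} ^ 3"
  assumes "indep3 u v w"
  obtains a b c where "x = a *s u + b *s v + c *s w"
proof -
  have "x \<in> range (\<lambda>(a, b, c). a *s u + b *s v + c *s w)"
    using bij_is_surj[OF indep3_bij[OF assms]] by simp
  then show ?thesis using that by auto
qed

lemma card_plane_le:
  fixes u v :: "'a::{field,finite} ^ 'n"
  shows "card {a *s u + b *s v | a b. True} \<le> CARD('a) ^ 2"
proof -
  have "{a *s u + b *s v | a b. True} = (\<lambda>(a, b). a *s u + b *s v) ` UNIV" by auto
  then show ?thesis
    using card_image_le[of "UNIV :: ('a \<times> 'a) set" "\<lambda>(a, b). a *s u + b *s v"]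
    by (simp add: power2_eq_square)
qed

lemma one_lt_card_field: "CARD('a::{field,finite}) > 1"
proof -
  have "card {0, 1::'a} \<le> CARD('a)" by (rule card_mono) auto
  then show ?thesis by simp
qed

text \<open>A plane has at most q^2 < q^3 vectors, so some vector lies outside it.\<close>

lemma indep3_complete:
  fixes u v :: "'a::{field,finite} ^ 3"
  assumes "u \<noteq> 0" "\<And>c. v \<noteq> c *s u"
  obtains w where "indep3 u v w"
proof -
  have "card {a *s u + b *s v | a b. True} < CARD('a ^ 3)"
    using card_plane_le[of u v] one_lt_card_field[where 'a='a]
    by (simp add: le_less_trans)
  then obtain w where "w \<notin> {a *s u + b *s v | a b. True}"
    by (metis (no_types, lifting) UNIV_eq_I less_irrefl)
  then show ?thesis using that indep3_extend[OF assms] by blast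
qed

section \<open>The field involution: fixed field, power form, Hilbert 90\<close>

text \<open>Translation by 1 permutes the field, so the sum of all elements does not change when q
  times 1 is added.\<close>

lemma char_dvd_card: "CHAR('a::{field,finite}) dvd CARD('a)"
proof -
  have "(\<Sum>x\<in>UNIV. x + 1) = (\<Sum>x\<in>UNIV. x :: 'a)"
    by (rule sum.reindex_bij_witness[of _ "\<lambda>x. x - 1" "\<lambda>x. x + 1"]) auto
  then have "of_nat CARD('a) = (0 :: 'a)" by (simp add: sum.distrib)
  then show ?thesis by (simp add: of_nat_eq_0_iff_char_dvd)
qed

locale field_involution =
  fixes \<sigma> :: "'a::{field,finite} \<Rightarrow> 'a"
  assumes aut: "field_automorphism \<sigma>"
    and involution: "\<sigma> \<circ> \<sigma> = id"
    and nontrivial: "\<sigma> \<noteq> id"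
begin

lemma sigma_sigma [simp]: "\<sigma> (\<sigma> x) = x"
  using involution by (metis comp_apply id_apply)

lemma sigma_1 [simp]: "\<sigma> 1 = 1" and sigma_add: "\<sigma> (a + b) = \<sigma> a + \<sigma> b"
  and sigma_mult: "\<sigma> (a * b) = \<sigma> a * \<sigma> b"
  using aut unfolding field_automorphism_def by auto

lemma sigma_0 [simp]: "\<sigma> 0 = 0"
  using sigma_add[of 0 0] by (metis add.right_neutral add_left_cancel)

lemma sigma_minus: "\<sigma> (- a) = - \<sigma> a"
  using sigma_add[of a "-a"] by (simp add: eq_neg_iff_add_eq_0 add.commute)

lemma sigma_diff: "\<sigma> (a - b) = \<sigma> a - \<sigma> b"
  using sigma_add[of a "-b"] by (simp add: sigma_minus)

lemma sigma_eq_0_iff [simp]: "\<sigma> a = 0 \<longleftrightarrow> a = 0"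
  by (metis sigma_sigma sigma_0)

lemma sigma_inverse: "\<sigma> (inverse a) = inverse (\<sigma> a)"
  by (cases "a = 0") (simp, metis inverse_unique right_inverse sigma_1 sigma_mult)

lemma sigma_divide: "\<sigma> (a / b) = \<sigma> a / \<sigma> b"
  by (simp add: divide_inverse sigma_mult sigma_inverse)

lemma sigma_sum: "\<sigma> (sum f A) = (\<Sum>x\<in>A. \<sigma> (f x))"
  by (induction A rule: infinite_finite_induct) (simp_all add: sigma_add)

lemmas sigma_simps = sigma_add sigma_mult sigma_minus sigma_diff sigma_divide

lemma obtain_moved: obtains t where "\<sigma> t \<noteq> t"
  using nontrivial by (metis eq_id_iff)

definition "fixed = {a. \<sigma> a = a}"

text \<open>Any \<open>t\<close> moved by \<sigma> gives a basis 1, \<open>t\<close> of the field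
  over \<open>fixed\<close>.\<close>

lemma card_fixed: "card fixed ^ 2 = CARD('a)"
proof -
  obtain t where t: "\<sigma> t \<noteq> t" by (rule obtain_moved)
  let ?f = "\<lambda>(a, b). a + b * t"
  have "bij_betw ?f (fixed \<times> fixed) UNIV"
    unfolding bij_betw_def
  proof
    show "inj_on ?f (fixed \<times> fixed)"
    proof (rule inj_onI, clarify)
      fix a b a' b' assume fx: "a \<in> fixed" "b \<in> fixed" "a' \<in> fixed" "b' \<in> fixed"
        and e: "a + b * t = a' + b' * t"
      from e have e1: "(b - b') * t = a' - a" by (simp add: algebra_simps)
      then have "\<sigma> ((b - b') * t) = \<sigma> (a' - a)" by simp
      then have "(b - b') * \<sigma> t = a' - a" using fx by (simp add: sigma_simps fixed_def)
      with e1 have "(b - b') * (\<sigma> t - t) = 0" by (simp only: right_diff_distrib diff_self)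
      with t have "b = b'" by simp
      with e1 show "a = a' \<and> b = b'" by simp
    qed
    show "?f ` (fixed \<times> fixed) = UNIV"
    proof (intro equalityI subsetI UNIV_I)
      fix x
      \<comment> \<open>Solves \<open>x = a + b * t\<close> together with its conjugate
        \<open>\<sigma> x = a + b * \<sigma> t\<close> for fixed \<open>a\<close> and
        \<open>b\<close>.\<close>
      define b where "b = (x - \<sigma> x) / (t - \<sigma> t)"
      have b: "b \<in> fixed"
        using t by (simp add: b_def fixed_def sigma_simps frac_eq_eq algebra_simps)
      have "b * (t - \<sigma> t) = x - \<sigma> x" using t by (simp add: b_def)
      then have "x - b * t \<in> fixed" using b by (simp add: fixed_def sigma_simps algebra_simps)
      with b show "x \<in> ?f ` (fixed \<times> fixed)"
        by (intro image_eqI[where x="(x - b * t, b)"]) auto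
    qed
  qed
  then have "card (fixed \<times> fixed) = CARD('a)" by (rule bij_betw_same_card)
  then show ?thesis by (simp add: card_cartesian_product power2_eq_square)
qed

text \<open>Fermat's argument in the fixed field: multiplication by a nonzero \<open>x\<close>
  permutes the nonzero fixed elements and hence preserves their product.\<close>

lemma power_card_fixed:
  assumes "x \<in> fixed"
  shows "x ^ card fixed = x"
proof (cases "x = 0")
  case True
  then show ?thesis using card_gt_0_iff[of fixed] assms by auto
next
  case False
  let ?P = "\<Prod>y\<in>fixed - {0}. y"
  have c: "card fixed = Suc (card (fixed - {0}))"
    by (rule card.remove) (auto simp: fixed_def)
  have "?P = (\<Prod>y\<in>fixed - {0}. x * y)"
    by (rule prod.reindex_bij_witness[of _ "\<lambda>y. x * y" "\<lambda>y. y / x"])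
      (use False assms in \<open>auto simp: fixed_def sigma_simps\<close>)
  also have "\<dots> = x ^ card (fixed - {0}) * ?P" by (simp add: prod.distrib)
  finally have "x ^ card (fixed - {0}) = 1" by simp
  then show ?thesis by (simp add: c)
qed

text \<open>A moved \<open>x\<close> is a root of Y^2 - tY + n, where its trace t and norm n are
  fixed. The map a -> a^s is additive and fixes t and n, so x^s is again a root, that is
  \<open>x\<close> or \<open>\<sigma> x\<close>; a root count excludes \<open>x\<close>.\<close>

lemma sigma_eq_power:
  assumes s: "primepow s" "CARD('a) = s ^ 2"
  shows "\<sigma> x = x ^ s"
proof (cases "x \<in> fixed")
  case True
  have sf: "card fixed = s" using card_fixed s(2) by simp
  show ?thesis using True power_card_fixed[OF True] sf by (simp add: fixed_def)
next
  case False
  have sf: "card fixed = s" using card_fixed s(2) by simp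
  have s1: "s > 1" using s(1) primepow_gt_Suc_0 by fastforce
  have pr: "prime CHAR('a)" using finite_imp_CHAR_pos[where 'a='a] prime_CHAR_semidom[where 'a='a] by simp
  obtain p k where p: "prime p" "k > 0" "s = p ^ k" using s(1) unfolding primepow_def by blast
  have "CHAR('a) dvd p ^ (k * 2)" using char_dvd_card[where 'a='a] s(2) p(3) by (simp add: power_mult)
  then have "CHAR('a) = p" using pr p(1) prime_dvd_power primes_dvd_imp_eq by blast
  then have add: "(a + b) ^ s = a ^ s + b ^ s" for a b :: 'a
    using freshmans_dream'[OF pr, of s k a b] p(3) by simp
  have fx: "a ^ s = a" if "a \<in> fixed" for a using power_card_fixed[OF that] sf by simp
  define t n where "t = x + \<sigma> x" and "n = x * \<sigma> x"
  have tn: "t ^ s = t" "n ^ s = n" by (intro fx; simp add: t_def n_def fixed_def sigma_simps algebra_simps)+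
  have "x * x + n = t * x" by (simp add: t_def n_def algebra_simps)
  then have "(x * x + n) ^ s = (t * x) ^ s" by simp
  \<comment> \<open>The quadratic factors as (Y - x)(Y - \<sigma> x), here evaluated at x^s.\<close>
  then have "(x ^ s - x) * (x ^ s - \<sigma> x) = 0"
    unfolding add power_mult_distrib tn by (simp add: t_def n_def algebra_simps)
  moreover have "x ^ s \<noteq> x"
  proof
    assume r: "x ^ s = x"
    let ?p = "Polynomial.monom 1 s - Polynomial.monom 1 1 :: 'a poly"
    have "coeff ?p s = 1" using s1 by simp
    then have p0: "?p \<noteq> 0" by (metis coeff_0 zero_neq_one)
    \<comment> \<open>Together with the s fixed elements, \<open>x\<close> would be root number s +
      1 of Y^s - Y.\<close>
    have "insert x fixed \<subseteq> {y. poly ?p y = 0}" using r fx by (auto simp: poly_monom)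
    then have "card (insert x fixed) \<le> card {y. poly ?p y = 0}" by (intro card_mono) auto
    also have "\<dots> \<le> degree ?p" by (rule card_poly_roots_bound[OF p0])
    also have "\<dots> \<le> s" using s1
      by (intro degree_diff_le) (auto intro: order_trans[OF degree_monom_le])
    finally show False using False sf by simp
  qed
  ultimately show ?thesis by simp
qed

text \<open>Every \<open>c = u + z * \<sigma> u\<close> satisfies the equation. If all of these
  vanished, u = 1 would give z = -1, and then \<sigma> would be the identity.\<close>

lemma hilbert90:
  assumes "z * \<sigma> z = 1"
  obtains c where "c \<noteq> 0" "z * \<sigma> c = c"
proof -
  have "\<exists>u. u + z * \<sigma> u \<noteq> 0"
  proof (rule ccontr)
    assume a: "\<nexists>u. u + z * \<sigma> u \<noteq> 0"
    from a have "1 + z * \<sigma> 1 = 0" by blast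
    then have "z = -1" by (simp add: eq_neg_iff_add_eq_0 add.commute)
    obtain t where "\<sigma> t \<noteq> t" by (rule obtain_moved)
    moreover have "t + z * \<sigma> t = 0" using a by blast
    ultimately show False using \<open>z = -1\<close> by simp
  qed
  then obtain u where u: "u + z * \<sigma> u \<noteq> 0" by blast
  have "z * \<sigma> (u + z * \<sigma> u) = z * \<sigma> u + (z * \<sigma> z) * u" by (simp add: sigma_simps algebra_simps)
  then show ?thesis using that[of "u + z * \<sigma> u"] u assms by (simp add: add.commute)
qed

end

section \<open>The row action of a matrix and the twist\<close>

lemma vector_matrix_add: "(u + v) v* M = u v* M + v v* M"
  by (simp add: vec_eq_iff vector_matrix_mult_def distrib_right sum.distrib)

lemma vector_matrix_scale: "(a *s u) v* M = a *s (u v* M)" for a :: "'a::comm_semiring_1"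
  by (simp add: vec_eq_iff vector_matrix_mult_def sum_distrib_left mult.assoc mult.left_commute)

lemma vector_matrix_eq_0:
  fixes M :: "'a::semiring_1 ^ 'n ^ 'm"
  assumes "\<And>x. x v* M = 0"
  shows "M = 0"
proof -
  have "M $ i $ j = 0" for i j
    using assms[of "axis i 1"]
    by (simp add: vec_eq_iff vector_matrix_mult_def axis_def if_distrib[of "\<lambda>x. x * _"] cong: if_cong)
  then show ?thesis by (simp add: vec_eq_iff)
qed

lemma indep3_scale:
  assumes "indep3 u v w" "a \<noteq> 0" "b \<noteq> 0" "c \<noteq> 0"
  shows "indep3 (a *s u) (b *s v) (c *s w)"
  using assms unfolding indep3_def by (fastforce simp: vec.scale_scale)

context field_involution
begin

lemma twist_scale: "twist \<sigma> (a *s x) = \<sigma> a *s twist \<sigma> x"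
  and twist_add: "twist \<sigma> (x + y) = twist \<sigma> x + twist \<sigma> y"
  and twist_twist [simp]: "twist \<sigma> (twist \<sigma> x) = x"
  and twist_0 [simp]: "twist \<sigma> 0 = 0"
  by (simp_all add: vec_eq_iff twist_def sigma_simps)

lemma twist_eq_0_iff [simp]: "twist \<sigma> x = 0 \<longleftrightarrow> x = 0"
  by (metis twist_0 twist_twist)

lemma twist_eq_iff: "twist \<sigma> x = y \<longleftrightarrow> x = twist \<sigma> y"
  by auto

lemma indep3_twist:
  assumes "indep3 u v w"
  shows "indep3 (twist \<sigma> u) (twist \<sigma> v) (twist \<sigma> w)"
  unfolding indep3_def
proof (intro allI impI)
  fix a b c assume "a *s twist \<sigma> u + b *s twist \<sigma> v + c *s twist \<sigma> w = 0"
  then have "twist \<sigma> (a *s twist \<sigma> u + b *s twist \<sigma> v + c *s twist \<sigma> w) = 0" by simp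
  then have "\<sigma> a *s u + \<sigma> b *s v + \<sigma> c *s w = 0" by (simp add: twist_add twist_scale)
  with assms have "\<sigma> a = 0 \<and> \<sigma> b = 0 \<and> \<sigma> c = 0" unfolding indep3_def by blast
  then show "a = 0 \<and> b = 0 \<and> c = 0" by simp
qed

section \<open>Counting eigenrows\<close>

text \<open>The twisted basis is again independent, so the eigenrow equation splits into one
  equation per coordinate, all with the same factor \<open>l\<close>.\<close>

lemma mem_eigenrows_iff:
  assumes i: "indep3 u v w"
    and M: "u v* M = \<alpha> *s twist \<sigma> u" "v v* M = \<beta> *s twist \<sigma> v" "w v* M = \<gamma> *s twist \<sigma> w"
  shows "a *s u + b *s v + c *s w \<in> eigenrows \<sigma> M \<longleftrightarrow>
    (\<exists>l. \<alpha> * a = l * \<sigma> a \<and> \<beta> * b = l * \<sigma> b \<and> \<gamma> * c = l * \<sigma> c)"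
proof -
  have "(a *s u + b *s v + c *s w) v* M =
      (\<alpha> * a) *s twist \<sigma> u + (\<beta> * b) *s twist \<sigma> v + (\<gamma> * c) *s twist \<sigma> w"
    by (simp add: vector_matrix_add vector_matrix_scale M mult.commute)
  moreover have "l *s twist \<sigma> (a *s u + b *s v + c *s w) =
      (l * \<sigma> a) *s twist \<sigma> u + (l * \<sigma> b) *s twist \<sigma> v + (l * \<sigma> c) *s twist \<sigma> w" for l
    by (simp add: twist_add twist_scale vec.scale_right_distrib)
  ultimately show ?thesis
    using indep3_coefficients_eq[OF indep3_twist[OF i]] by (auto simp: eigenrows_def) blast
qed

text \<open>Multiples of vectors over the fixed field are eigenrows of the identity. Scaling the
  first nonzero coordinate to 1 sorts them into three disjoint families, whose sizes add up to the
  bound because \<open>card fixed ^ 2\<close> is q.\<close>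

lemma card_eigenrows_one_ge:
  "CARD('a) ^ 2 + (CARD('a) - 1) * card fixed \<le>
    card (eigenrows \<sigma> (mat 1 :: 'a ^ 3 ^ 3))"
  (is "_ \<le> card ?E")
proof -
  have memE: "c *s v \<in> ?E" if "twist \<sigma> v = v" for c v
  proof -
    \<comment> \<open>For c = 0 both sides are 0, since 0 / 0 = 0.\<close>
    have "c *s v = (c / \<sigma> c) *s twist \<sigma> (c *s v)" by (simp add: that twist_scale)
    then show ?thesis unfolding eigenrows_def
      by (metis (mono_tags, lifting) mem_Collect_eq vector_matrix_mul_rid)
  qed
  let ?f = "\<lambda>(c, b, d). c *s vector [1, b, d] :: 'a ^ 3"
  let ?g = "\<lambda>(c, d). c *s vector [0, 1, d] :: 'a ^ 3"
  let ?h = "\<lambda>c. c *s vector [0, 0, 1] :: 'a ^ 3"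
  let ?U = "UNIV - {0 :: 'a}"
  \<comment> \<open>Only \<open>?C\<close> admits the scalar 0, so the zero row is counted exactly
    once.\<close>
  let ?A = "?f ` (?U \<times> fixed \<times> fixed)" and ?B = "?g ` (?U \<times> fixed)" and ?C = "range ?h"
  have f: "inj_on ?f (?U \<times> fixed \<times> fixed)" and g: "inj_on ?g (?U \<times> fixed)" and h: "inj ?h"
    by (auto simp: inj_on_def vec_eq_iff forall_3)
  have "?A \<inter> ?B = {}" "(?A \<union> ?B) \<inter> ?C = {}"
    by (auto simp: vec_eq_iff forall_3)
  then have "card (?A \<union> ?B \<union> ?C) = card ?A + card ?B + card ?C"
    by (simp add: card_Un_disjoint)
  also have "card ?A = (CARD('a) - 1) * card fixed ^ 2"
    by (simp add: card_image[OF f] card_cartesian_product card_Diff_singleton power2_eq_square)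
  also have "card ?B = (CARD('a) - 1) * card fixed"
    by (simp add: card_image[OF g] card_cartesian_product card_Diff_singleton)
  also have "card ?C = CARD('a)"
    by (simp add: card_image[OF h])
  finally have "card (?A \<union> ?B \<union> ?C) =
    (CARD('a) - 1) * CARD('a) + (CARD('a) - 1) * card fixed + CARD('a)"
    by (simp add: card_fixed)
  moreover have "?A \<union> ?B \<union> ?C \<subseteq> ?E"
    by (auto intro!: memE simp: twist_def vec_eq_iff forall_3 fixed_def)
  then have "card (?A \<union> ?B \<union> ?C) \<le> card ?E" by (intro card_mono) auto
  moreover have "(CARD('a) - 1) * CARD('a) + CARD('a) = CARD('a) ^ 2"
    using one_lt_card_field[where 'a='a] by (simp add: power2_eq_square algebra_simps)
  ultimately show ?thesis by linarith
qed

text \<open>In the row (1, t, 0) the first coordinate forces the factor 1, which fails at a moved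
  \<open>t\<close>.\<close>

lemma eigenrows_one_neq_UNIV: "eigenrows \<sigma> (mat 1 :: 'a ^ 3 ^ 3) \<noteq> UNIV"
proof
  assume a: "eigenrows \<sigma> (mat 1 :: 'a ^ 3 ^ 3) = UNIV"
  obtain t where t: "\<sigma> t \<noteq> t" by (rule obtain_moved)
  have "vector [1, t, 0] \<in> eigenrows \<sigma> (mat 1 :: 'a ^ 3 ^ 3)" using a by simp
  then obtain l where "vector [1, t, 0] = l *s twist \<sigma> (vector [1, t, 0] :: 'a ^ 3)"
    unfolding eigenrows_def by auto
  then show False using t by (auto simp: vec_eq_iff forall_3 twist_def)
qed

text \<open>Passing from \<open>\<xi>\<close> to \<open>c *s \<xi>\<close> multiplies the eigenvalue
  by \<open>c / \<sigma> c\<close>. Hilbert 90 writes the norm-one quotient \<open>m / l\<close> in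
  this form.\<close>

lemma scale_eigenrow:
  assumes "\<xi> v* M = l *s twist \<sigma> \<xi>" "l \<noteq> 0" "l * \<sigma> l = m * \<sigma> m"
  obtains c where "c \<noteq> 0" "(c *s \<xi>) v* M = m *s twist \<sigma> (c *s \<xi>)"
proof -
  have "m \<noteq> 0" using assms(2,3) by auto
  then have "(m / l) * \<sigma> (m / l) = 1" using assms(2,3) by (simp add: sigma_simps)
  then obtain c where c: "c \<noteq> 0" "(m / l) * \<sigma> c = c" by (rule hilbert90)
  then have "c * l = m * \<sigma> c" using assms(2) by (simp add: field_simps)
  then have "(c *s \<xi>) v* M = m *s twist \<sigma> (c *s \<xi>)"
    by (simp add: vector_matrix_scale twist_scale assms(1))
  with c(1) that show ?thesis by blast
qed

text \<open>Rescaling \<open>v\<close> and \<open>w\<close> gives all three basis vectors the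
  eigenvalue \<open>\<alpha>\<close>. Coordinates in that basis then match the eigenrows of
  \<open>M\<close> with those of the identity, the factor \<open>l\<close> changing by
  \<open>\<alpha>\<close>.\<close>

lemma card_eigenrows_same_norm:
  fixes M :: "'a ^ 3 ^ 3"
  assumes i: "indep3 u v w"
    and M: "u v* M = \<alpha> *s twist \<sigma> u" "v v* M = \<beta> *s twist \<sigma> v" "w v* M = \<gamma> *s twist \<sigma> w"
    and nz: "\<alpha> \<noteq> 0" "\<beta> \<noteq> 0" "\<gamma> \<noteq> 0"
    and norm: "\<alpha> * \<sigma> \<alpha> = \<beta> * \<sigma> \<beta>" "\<beta> * \<sigma> \<beta> = \<gamma> * \<sigma> \<gamma>"
  shows "card (eigenrows \<sigma> M) = card (eigenrows \<sigma> (mat 1 :: 'a ^ 3 ^ 3))"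
proof -
  obtain b where b: "b \<noteq> 0" "(b *s v) v* M = \<alpha> *s twist \<sigma> (b *s v)"
    by (rule scale_eigenrow[OF M(2) nz(2) norm(1)[symmetric]])
  obtain c where c: "c \<noteq> 0" "(c *s w) v* M = \<alpha> *s twist \<sigma> (c *s w)"
    by (rule scale_eigenrow[OF M(3) nz(3), of \<alpha>]) (use norm in simp)
  define v' w' where "v' = b *s v" and "w' = c *s w"
  have i': "indep3 u v' w'"
    using indep3_scale[OF i, of 1 b c] b(1) c(1) by (simp add: v'_def w'_def)
  let ?f = "\<lambda>x :: 'a ^ 3. x $ 1 *s u + x $ 2 *s v' + x $ 3 *s w'"
  have mem: "?f x \<in> eigenrows \<sigma> M \<longleftrightarrow> x \<in> eigenrows \<sigma> (mat 1)" for x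
  proof -
    have "?f x \<in> eigenrows \<sigma> M \<longleftrightarrow> (\<exists>l. \<forall>i. \<alpha> * x $ i = l * \<sigma> (x $ i))"
      using mem_eigenrows_iff[OF i' M(1) b(2)[folded v'_def] c(2)[folded w'_def]]
      by (simp add: forall_3)
    also have "\<dots> \<longleftrightarrow> (\<exists>l. \<forall>i. x $ i = l * \<sigma> (x $ i))"
    proof (intro iffI; elim exE)
      fix l assume "\<forall>i. \<alpha> * x $ i = l * \<sigma> (x $ i)"
      then have "\<forall>i. x $ i = (l / \<alpha>) * \<sigma> (x $ i)" using nz(1) by (simp add: field_simps)
      then show "\<exists>l. \<forall>i. x $ i = l * \<sigma> (x $ i)" by blast
    next
      fix l assume "\<forall>i. x $ i = l * \<sigma> (x $ i)"
      then have "\<forall>i. \<alpha> * x $ i = (\<alpha> * l) * \<sigma> (x $ i)" by (simp add: mult.assoc)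
      then show "\<exists>l. \<forall>i. \<alpha> * x $ i = l * \<sigma> (x $ i)" by blast
    qed
    also have "\<dots> \<longleftrightarrow> x \<in> eigenrows \<sigma> (mat 1)"
      by (simp add: eigenrows_def vec_eq_iff twist_def)
    finally show ?thesis .
  qed
  have inj: "inj ?f"
  proof (rule injI)
    fix x y assume "?f x = ?f y"
    from indep3_coefficients_eq[OF i' this] show "x = y" unfolding vec_eq_iff forall_3 .
  qed
  have "eigenrows \<sigma> M = ?f ` eigenrows \<sigma> (mat 1)"
  proof (intro equalityI subsetI)
    fix y assume y: "y \<in> eigenrows \<sigma> M"
    obtain a1 a2 a3 where "y = a1 *s u + a2 *s v' + a3 *s w'" by (rule indep3_expand[OF i'])
    then have "y = ?f (vector [a1, a2, a3])" by simp
    then show "y \<in> ?f ` eigenrows \<sigma> (mat 1)" using y mem by blast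
  qed (use mem in blast)
  then show ?thesis using inj by (simp add: card_image inj_on_subset)
qed

text \<open>A nonzero coordinate of an eigenrow forces its basis eigenvalue to have the norm of the
  common factor \<open>l\<close>. Hence the \<open>u\<close> coordinate cannot be nonzero together
  with another one.\<close>

lemma card_eigenrows_odd_norm_le:
  fixes M :: "'a ^ 3 ^ 3"
  assumes i: "indep3 u v w"
    and M: "u v* M = \<alpha> *s twist \<sigma> u" "v v* M = \<beta> *s twist \<sigma> v" "w v* M = \<gamma> *s twist \<sigma> w"
    and norm: "\<alpha> * \<sigma> \<alpha> \<noteq> \<beta> * \<sigma> \<beta>" "\<alpha> * \<sigma> \<alpha> \<noteq> \<gamma> * \<sigma> \<gamma>"
  shows "card (eigenrows \<sigma> M) \<le> CARD('a) ^ 2 + CARD('a)"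
proof -
  have both: "False" if e: "l * \<sigma> a = m * a" "l * \<sigma> b = k * b" and "a \<noteq> 0" "b \<noteq> 0"
    and n: "m * \<sigma> m \<noteq> k * \<sigma> k" for a b l m k
  proof -
    \<comment> \<open>The equation is multiplied by its conjugate, and \<open>a * \<sigma> a\<close>
      cancels.\<close>
    have N: "m * \<sigma> m = l * \<sigma> l" if e: "l * \<sigma> a = m * a" "a \<noteq> 0" for a m
    proof -
      have "\<sigma> (l * \<sigma> a) = \<sigma> (m * a)" using e by simp
      then have "\<sigma> l * a = \<sigma> m * \<sigma> a" by (simp add: sigma_mult)
      then have "(l * \<sigma> a) * (\<sigma> l * a) = (m * a) * (\<sigma> m * \<sigma> a)" using e by simp
      then have "(l * \<sigma> l) * (a * \<sigma> a) = (m * \<sigma> m) * (a * \<sigma> a)" by (simp add: ac_simps)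
      then show ?thesis using \<open>a \<noteq> 0\<close> by simp
    qed
    from N[OF e(1)] N[OF e(2)] that show False by simp
  qed
  have "eigenrows \<sigma> M \<subseteq> range (\<lambda>a. a *s u) \<union> {b *s v + c *s w | b c. True}"
  proof
    fix y assume y: "y \<in> eigenrows \<sigma> M"
    obtain a b c where yy: "y = a *s u + b *s v + c *s w" by (rule indep3_expand[OF i])
    with y obtain l where l: "\<alpha> * a = l * \<sigma> a" "\<beta> * b = l * \<sigma> b" "\<gamma> * c = l * \<sigma> c"
      using mem_eigenrows_iff[OF i M] by blast
    have "a = 0 \<or> (b = 0 \<and> c = 0)"
      using both[OF l(1,2)[symmetric]] both[OF l(1,3)[symmetric]] norm by blast
    then show "y \<in> range (\<lambda>a. a *s u) \<union> {b *s v + c *s w | b c. True}"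
    proof
      assume "a = 0"
      then have "y = b *s v + c *s w" using yy by simp
      then show ?thesis by blast
    next
      assume "b = 0 \<and> c = 0"
      then have "y = a *s u" using yy by simp
      then show ?thesis by (blast intro: rangeI)
    qed
  qed
  then have "card (eigenrows \<sigma> M) \<le> card (range (\<lambda>a. a *s u) \<union> {b *s v + c *s w | b c. True})"
    by (intro card_mono) auto
  also have "\<dots> \<le> card (range (\<lambda>a. a *s u)) + card {b *s v + c *s w | b c. True}"
    by (rule card_Un_le)
  also have "\<dots> \<le> CARD('a) + CARD('a) ^ 2"
    by (intro add_mono card_plane_le card_image_le) auto
  finally show ?thesis by simp
qed

text \<open>Eigenrows need not form a subspace, but two independent ones span a plane that must
  contain all the others; without such a pair they lie on a line.\<close>

lemma card_eigenrows_no_indep3_le: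
  fixes M :: "'a ^ 3 ^ 3"
  assumes no: "\<And>u v w. u \<in> eigenrows \<sigma> M \<Longrightarrow> v \<in> eigenrows \<sigma> M \<Longrightarrow> w \<in> eigenrows \<sigma> M
      \<Longrightarrow> \<not> indep3 u v w"
  shows "card (eigenrows \<sigma> M) \<le> CARD('a) ^ 2"
proof -
  let ?E = "eigenrows \<sigma> M"
  have "\<exists>u v. ?E \<subseteq> {a *s u + b *s v | a b. True}"
  proof (cases "\<exists>u v. u \<in> ?E \<and> v \<in> ?E \<and> u \<noteq> 0 \<and> (\<forall>c. v \<noteq> c *s u)")
    case True
    then obtain u v where uv: "u \<in> ?E" "v \<in> ?E" "u \<noteq> 0" "\<And>c. v \<noteq> c *s u" by blast
    have "?E \<subseteq> {a *s u + b *s v | a b. True}"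
      using indep3_extend[OF uv(3,4)] no[OF uv(1,2)] by blast
    then show ?thesis by blast
  next
    case no2: False
    show ?thesis
    proof (cases "?E \<subseteq> {0}")
      case True
      moreover have "(0 :: 'a ^ 3) = 0 *s 0 + 0 *s 0" by simp
      ultimately show ?thesis by blast
    next
      case False
      then obtain u where u: "u \<in> ?E" "u \<noteq> 0" by blast
      have "\<exists>a b. y = a *s u + b *s 0" if y: "y \<in> ?E" for y
      proof -
        obtain c where "y = c *s u" using no2 u y by blast
        then have "y = c *s u + 0 *s 0" by simp
        then show ?thesis by blast
      qed
      then show ?thesis by blast
    qed
  qed
  then obtain u v where "?E \<subseteq> {a *s u + b *s v | a b. True}" by blast
  then have "card ?E \<le> card {a *s u + b *s v | a b. True}" by (intro card_mono) auto
  also note card_plane_le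
  finally show ?thesis .
qed

text \<open>The criterion of the theorem, with the norm as a product of conjugates instead of a
  power.\<close>

definition equal_norm_basis :: "'a ^ 3 ^ 3 \<Rightarrow> bool" where
  "equal_norm_basis M \<longleftrightarrow> (\<exists>u v w \<alpha> \<beta> \<gamma>. indep3 u v w \<and> \<alpha> \<noteq> 0 \<and> \<beta> \<noteq> 0 \<and> \<gamma> \<noteq> 0 \<and>
     u v* M = \<alpha> *s twist \<sigma> u \<and> v v* M = \<beta> *s twist \<sigma> v \<and> w v* M = \<gamma> *s twist \<sigma> w \<and>
     \<alpha> * \<sigma> \<alpha> = \<beta> * \<sigma> \<beta> \<and> \<beta> * \<sigma> \<beta> = \<gamma> * \<sigma> \<gamma>)"

lemma card_eigenrows_not_equal_norm_basis:
  assumes "M \<noteq> 0" "\<not> equal_norm_basis M"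
  shows "card (eigenrows \<sigma> M) \<le> CARD('a) ^ 2 + CARD('a)"
proof (cases "\<exists>u v w. u \<in> eigenrows \<sigma> M \<and> v \<in> eigenrows \<sigma> M \<and> w \<in> eigenrows \<sigma> M \<and> indep3 u v w")
  case False
  then show ?thesis using card_eigenrows_no_indep3_le[of M] by (meson trans_le_add1)
next
  case True
  then obtain u v w \<alpha> \<beta> \<gamma> where i: "indep3 u v w"
    and M: "u v* M = \<alpha> *s twist \<sigma> u" "v v* M = \<beta> *s twist \<sigma> v" "w v* M = \<gamma> *s twist \<sigma> w"
    unfolding eigenrows_def by blast
  have i2: "indep3 v w u" and i3: "indep3 w u v" using i by (blast intro: indep3_rotate)+
  have "\<not> (\<alpha> * \<sigma> \<alpha> = \<beta> * \<sigma> \<beta> \<and> \<beta> * \<sigma> \<beta> = \<gamma> * \<sigma> \<gamma>)"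
  proof
    assume n: "\<alpha> * \<sigma> \<alpha> = \<beta> * \<sigma> \<beta> \<and> \<beta> * \<sigma> \<beta> = \<gamma> * \<sigma> \<gamma>"
    show False
    \<comment> \<open>With equal norms the eigenvalues vanish together, and then \<open>M\<close>
      kills a basis; otherwise the basis is one that \<open>equal_norm_basis\<close> asks
      for.\<close>
    proof (cases "\<alpha> = 0")
      case True
      with n have z: "\<beta> = 0" "\<gamma> = 0" by auto
      have "x v* M = 0" for x
      proof -
        obtain a b c where "x = a *s u + b *s v + c *s w" by (rule indep3_expand[OF i])
        then show ?thesis using M True z by (simp add: vector_matrix_add vector_matrix_scale)
      qed
      then show False using assms(1) vector_matrix_eq_0 by blast
    next
      case False
      with n have "\<beta> \<noteq> 0" "\<gamma> \<noteq> 0" by auto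
      with False n i M assms(2) show False unfolding equal_norm_basis_def by blast
    qed
  qed
  \<comment> \<open>Of three values that are not all equal, one differs from both others; rotating
    the basis puts it first.\<close>
  then consider "\<alpha> * \<sigma> \<alpha> \<noteq> \<beta> * \<sigma> \<beta>" "\<alpha> * \<sigma> \<alpha> \<noteq> \<gamma> * \<sigma> \<gamma>"
    | "\<beta> * \<sigma> \<beta> \<noteq> \<gamma> * \<sigma> \<gamma>" "\<beta> * \<sigma> \<beta> \<noteq> \<alpha> * \<sigma> \<alpha>"
    | "\<gamma> * \<sigma> \<gamma> \<noteq> \<alpha> * \<sigma> \<alpha>" "\<gamma> * \<sigma> \<gamma> \<noteq> \<beta> * \<sigma> \<beta>"
    by metis
  then show ?thesis
    using card_eigenrows_odd_norm_le[OF i M] card_eigenrows_odd_norm_le[OF i2 M(2,3,1)]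
      card_eigenrows_odd_norm_le[OF i3 M(3,1,2)] by cases blast+
qed

text \<open>Since \<open>card fixed\<close> is at least 2 and q at least 4, the surplus (q - 1)
  \<open>card fixed\<close> over q^2 is at least 2q - 2, which exceeds q.\<close>

lemma card_eigenrows_less:
  assumes "M \<noteq> 0" "\<not> equal_norm_basis M"
  shows "card (eigenrows \<sigma> M) < card (eigenrows \<sigma> (mat 1 :: 'a ^ 3 ^ 3))"
proof -
  have s: "card fixed \<ge> 2"
  proof -
    have "card fixed \<noteq> 0" "card fixed \<noteq> 1" 
      using card_fixed one_lt_card_field[where 'a='a] by auto
    then show ?thesis by linarith
  qed
  then have "(CARD('a) - 1) * 2 \<le> (CARD('a) - 1) * card fixed" by (rule mult_le_mono2)
  moreover have "CARD('a) \<ge> 4"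
    using power_mono[OF s, of 2] card_fixed by simp
  ultimately show ?thesis
    using card_eigenrows_not_equal_norm_basis[OF assms] card_eigenrows_one_ge by linarith
qed

lemma card_eigenrows_equal_norm_basis:
  "equal_norm_basis M \<Longrightarrow> card (eigenrows \<sigma> M) = card (eigenrows \<sigma> (mat 1 :: 'a ^ 3 ^ 3))"
  unfolding equal_norm_basis_def using card_eigenrows_same_norm by blast

end

section \<open>Pairing of rows and columns, traces and projective points\<close>

lemma row_times_col_scale_left: "row_times_col (a *s \<xi>) x = a * row_times_col \<xi> x"
  and row_times_col_scale_right: "row_times_col \<xi> (a *s x) = a * row_times_col \<xi> x"
  for a :: "'a::comm_semiring_1"
  by (simp_all add: row_times_col_def sum_distrib_left ac_simps)

lemma row_times_col_add_left: "row_times_col (\<xi> + \<eta>) x = row_times_col \<xi> x + row_times_col \<eta> x"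
  by (simp add: row_times_col_def distrib_right sum.distrib)

lemma row_times_col_diff_right: "row_times_col \<xi> (x - y) = row_times_col \<xi> x - row_times_col \<xi> y"
  for \<xi> :: "'a::ring_1 ^ 'n"
  by (simp add: row_times_col_def right_diff_distrib sum_subtractf)

lemma row_times_col_0_left [simp]: "row_times_col 0 x = 0"
  and row_times_col_0_right [simp]: "row_times_col \<xi> 0 = 0"
  by (simp_all add: row_times_col_def)

lemma row_times_col_axis: "row_times_col (axis i 1) x = x $ i"
  by (simp add: row_times_col_def axis_def if_distrib[of "\<lambda>a. a * _"] cong: if_cong)

text \<open>Cyclicity of the trace: it turns an entry of the codeword into the value of the row
  \<xi>M at a column.\<close>

lemma trace_col_times_row:
  fixes M :: "'a::comm_semiring_1 ^ 'n ^ 'n"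
  shows "trace (col_times_row x \<xi> ** M) = row_times_col (\<xi> v* M) x"
  by (simp add: trace_def matrix_matrix_mult_def col_times_row_def row_times_col_def
      vector_matrix_mult_def sum_distrib_left sum_distrib_right ac_simps)

lemma proj_point_eq_imp_multiple:
  assumes "proj_point X = proj_point Y"
  obtains c where "\<forall>i j. X $ i $ j = c * Y $ i $ j"
proof -
  have "X \<in> proj_point X"
    unfolding proj_point_def by (auto intro!: exI[of _ 1] simp: vec_eq_iff)
  then have "X \<in> proj_point Y" using assms by simp
  then show ?thesis using that unfolding proj_point_def by (auto simp: vec_eq_iff)
qed

lemma proj_point_scale:
  assumes "c \<noteq> 0" "\<And>i j. X $ i $ j = c * Y $ i $ j"
  shows "proj_point X = proj_point Y"
proof -
  have "\<exists>d. \<forall>i j. a * Y $ i $ j = d * X $ i $ j" for a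
    using assms by (intro exI[of _ "a / c"]) simp
  moreover have "\<exists>d. \<forall>i j. a * X $ i $ j = d * Y $ i $ j" for a
    using assms(2) by (intro exI[of _ "a * c"]) (simp add: mult.assoc)
  ultimately show ?thesis
    unfolding proj_point_def by (fastforce simp: vec_eq_iff)
qed

lemma trace_multiple:
  fixes M :: "'a::comm_semiring_1 ^ 'n ^ 'n"
  assumes "\<forall>i j. X $ i $ j = c * Y $ i $ j"
  shows "trace (X ** M) = c * trace (Y ** M)"
  by (simp add: trace_def matrix_matrix_mult_def assms sum_distrib_left mult.assoc)

text \<open>Matrices spanning the same point are multiples of each other, so the support of a
  codeword depends on the points and not on the representatives.\<close>

lemma trace_eq_0_proj_point:
  assumes "proj_point X = proj_point Y"
  shows "trace (X ** M) = 0 \<longleftrightarrow> trace (Y ** M) = 0"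
proof -
  obtain c where "\<forall>i j. X $ i $ j = c * Y $ i $ j" using assms by (rule proj_point_eq_imp_multiple)
  moreover obtain d where "\<forall>i j. Y $ i $ j = d * X $ i $ j"
    using assms[symmetric] by (rule proj_point_eq_imp_multiple)
  ultimately show ?thesis using trace_multiple by (metis mult_zero_right)
qed

text \<open>Comparing one column and one row through a nonzero entry recovers both factors up to
  scalars, so a point of \<open>Lambda\<close> determines its flag.\<close>

lemma col_times_row_eq_multiple:
  fixes x y \<xi> \<eta> :: "'a::field ^ 'n"
  assumes e: "\<forall>i j. col_times_row x \<xi> $ i $ j = k * col_times_row y \<eta> $ i $ j"
    and nz: "x \<noteq> 0" "\<xi> \<noteq> 0"
  obtains c d where "x = c *s y" "\<xi> = d *s \<eta>"
proof -
  have e': "x $ i * \<xi> $ j = k * (y $ i * \<eta> $ j)" for i j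
    using e by (simp add: col_times_row_def)
  obtain i0 j0 where 0: "x $ i0 \<noteq> 0" "\<xi> $ j0 \<noteq> 0" using nz by (auto simp: vec_eq_iff)
  have "x = (k * \<eta> $ j0 / \<xi> $ j0) *s y" using e'[of _ j0] 0 by (simp add: vec_eq_iff field_simps)
  moreover have "\<xi> = (k * y $ i0 / x $ i0) *s \<eta>"
    using e'[of i0] 0 by (simp add: vec_eq_iff field_simps)
  ultimately show ?thesis by (rule that)
qed

section \<open>From weights to eigenrows by counting flags\<close>

text \<open>Completing \<open>\<xi>\<close>, \<open>\<eta>\<close> to a basis of rows makes the
  three values independent coordinates on columns: one is zero, one nonzero, one free.\<close>

lemma card_row_kernel_minus:
  fixes \<xi> \<eta> :: "'a::{field,finite} ^ 3"
  assumes "\<xi> \<noteq> 0" "\<And>c. \<eta> \<noteq> c *s \<xi>"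
  shows "card {x. row_times_col \<xi> x = 0 \<and> row_times_col \<eta> x \<noteq> 0} = (CARD('a) - 1) * CARD('a)"
proof -
  obtain \<zeta> where i: "indep3 \<xi> \<eta> \<zeta>" using assms by (rule indep3_complete)
  let ?f = "\<lambda>x. (row_times_col \<xi> x, row_times_col \<eta> x, row_times_col \<zeta> x)"
  have inj: "inj ?f"
  proof (rule injI)
    fix x y assume "?f x = ?f y"
    then have 0: "row_times_col \<xi> (x - y) = 0" "row_times_col \<eta> (x - y) = 0" "row_times_col \<zeta> (x - y) = 0"
      by (simp_all add: row_times_col_diff_right)
    \<comment> \<open>A column killed by a basis of rows is killed by every row, in particular by
      those reading off its coordinates.\<close>
    have "row_times_col \<theta> (x - y) = 0" for \<theta>
    proof -
      obtain a b c where "\<theta> = a *s \<xi> + b *s \<eta> + c *s \<zeta>" by (rule indep3_expand[OF i])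
      then show ?thesis by (simp add: row_times_col_add_left row_times_col_scale_left 0)
    qed
    then have "(x - y) $ i = 0" for i using row_times_col_axis by metis
    then show "x = y" by (simp add: vec_eq_iff)
  qed
  have "range ?f = UNIV"
    by (rule card_subset_eq) (simp_all add: card_image[OF inj] power3_eq_cube)
  then have "bij ?f" using inj by (simp add: bij_def)
  then have "card {x. ?f x \<in> {0} \<times> (UNIV - {0}) \<times> UNIV} =
      card ({0 :: 'a} \<times> (UNIV - {0 :: 'a}) \<times> (UNIV :: 'a set))"
    by (intro card_vimage_inj[where f = ?f, unfolded vimage_def]) (auto simp: bij_def)
  then show ?thesis by (simp add: card_cartesian_product card_Diff_singleton)
qed

lemma card_pairs_fibres:
  fixes P :: "'b::finite \<Rightarrow> 'c::finite \<Rightarrow> bool"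
  assumes "\<And>y. y \<in> A \<Longrightarrow> card {x. P x y} = 0" "\<And>y. y \<notin> A \<Longrightarrow> card {x. P x y} = k"
  shows "card {(x, y). P x y} = (CARD('c) - card A) * k"
proof -
  have "card {(x, y). P x y} = card (SIGMA y:UNIV. {x. P x y})"
    by (rule bij_betw_same_card[of "\<lambda>(x, y). (y, x)"]) (auto simp: bij_betw_def inj_on_def)
  also have "\<dots> = (\<Sum>y\<in>UNIV. card {x. P x y})" by (simp add: card_SigmaI)
  also have "\<dots> = (\<Sum>y\<in>UNIV. if y \<in> - A then k else 0)" by (rule sum.cong) (auto simp: assms)
  also have "\<dots> = card (- A) * k" by (simp add: sum.If_cases Compl_eq)
  also have "card (- A) = CARD('c) - card A" by (simp add: Compl_eq_Diff_UNIV card_Diff_subset)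
  finally show ?thesis .
qed

context field_involution
begin

lemma row_times_col_twist: "row_times_col (twist \<sigma> \<xi>) (twist \<sigma> x) = \<sigma> (row_times_col \<xi> x)"
  by (simp add: row_times_col_def twist_def sigma_sum sigma_mult)

text \<open>The inequality forces both vectors to be nonzero, so these are the pairs of vectors
  spanning flags where the codeword does not vanish.\<close>

definition flag_pairs :: "'a ^ 'n ^ 'n \<Rightarrow> (('a ^ 'n) \<times> ('a ^ 'n)) set" where
  "flag_pairs M = {(x, \<xi>). row_times_col \<xi> x = 0 \<and> row_times_col (\<xi> v* M) (twist \<sigma> x) \<noteq> 0}"

text \<open>With \<open>\<eta> = twist \<sigma> (\<xi> v* M)\<close>, the value of \<xi>M at the
  twisted column is the conjugate of \<eta>x. The row \<open>\<eta>\<close> is a multiple of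
  \<open>\<xi>\<close> exactly for eigenrows, which give empty fibres; all other fibres have the
  same size.\<close>

lemma card_flag_pairs:
  fixes M :: "'a ^ 3 ^ 3"
  shows "card (flag_pairs M) =
    (CARD('a) ^ 3 - card (eigenrows \<sigma> M)) * ((CARD('a) - 1) * CARD('a))"
proof -
  have "card {x. row_times_col \<xi> x = 0 \<and> row_times_col (\<xi> v* M) (twist \<sigma> x) \<noteq> 0} = 0"
    if "\<xi> \<in> eigenrows \<sigma> M" for \<xi>
  proof -
    obtain l where "\<xi> v* M = l *s twist \<sigma> \<xi>" using \<open>\<xi> \<in> _\<close> unfolding eigenrows_def by blast
    then show ?thesis by (simp add: row_times_col_scale_left row_times_col_twist)
  qed
  moreover have "card {x. row_times_col \<xi> x = 0 \<and> row_times_col (\<xi> v* M) (twist \<sigma> x) \<noteq> 0} =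
      (CARD('a) - 1) * CARD('a)" if "\<xi> \<notin> eigenrows \<sigma> M" for \<xi>
  proof -
    define \<eta> where "\<eta> = twist \<sigma> (\<xi> v* M)"
    have M: "\<xi> v* M = twist \<sigma> \<eta>" by (simp add: \<eta>_def)
    have "0 \<in> eigenrows \<sigma> M" by (simp add: eigenrows_def)
    then have "\<xi> \<noteq> 0" using that by blast
    moreover have "\<eta> \<noteq> c *s \<xi>" for c
    proof
      assume "\<eta> = c *s \<xi>"
      then have "\<xi> v* M = \<sigma> c *s twist \<sigma> \<xi>" by (simp add: M twist_scale)
      then show False using that unfolding eigenrows_def by blast
    qed
    ultimately show ?thesis
      using card_row_kernel_minus[of \<xi> \<eta>] by (simp add: M row_times_col_twist)
  qed
  ultimately show ?thesis
    unfolding flag_pairs_def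
    by (subst card_pairs_fibres[where A = "eigenrows \<sigma> M" and k = "(CARD('a) - 1) * CARD('a)"]) simp_all
qed

text \<open>Each nonzero entry belongs to one flag, and the two vectors of that flag can be rescaled
  independently, in (q - 1)^2 ways.\<close>

lemma hamming_weight_codeword:
  fixes M :: "'a ^ 'n ^ 'n"
  assumes rep: "representatives Xs (Lambda \<sigma>)"
  shows "hamming_weight (codeword Xs M) * (CARD('a) - 1) ^ 2 = card (flag_pairs M)"
proof -
  define pt where "pt x \<xi> = proj_point (col_times_row (twist \<sigma> x) \<xi>)" for x \<xi> :: "'a ^ 'n"
  define I where "I = {i. i < length Xs \<and> trace (Xs ! i ** M) \<noteq> 0}"
  have "\<exists>x \<xi>. proj_point (Xs ! i) = pt x \<xi> \<and> x \<noteq> 0 \<and> \<xi> \<noteq> 0 \<and> row_times_col \<xi> x = 0"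
    if "i < length Xs" for i
  proof -
    have "proj_point (Xs ! i) \<in> Lambda \<sigma>" using rep that unfolding representatives_def by auto
    then show ?thesis unfolding Lambda_def pt_def by blast
  qed
  then obtain x \<xi> where p: "proj_point (Xs ! i) = pt (x i) (\<xi> i)" "x i \<noteq> 0" "\<xi> i \<noteq> 0"
      "row_times_col (\<xi> i) (x i) = 0" if "i < length Xs" for i
    by metis
  have pt_scale: "pt (c *s y) (d *s \<eta>) = pt y \<eta>" if "c \<noteq> 0" "d \<noteq> 0" for c d y \<eta>
    unfolding pt_def
    by (rule proj_point_scale[of "\<sigma> c * d"])
      (use that in \<open>simp_all add: col_times_row_def twist_def sigma_mult\<close>)
  have pair: "(y, \<eta>) \<in> flag_pairs M \<longleftrightarrow> row_times_col \<eta> y = 0 \<and> trace (Xs ! i ** M) \<noteq> 0"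
    if "proj_point (Xs ! i) = pt y \<eta>" for i y \<eta>
    using trace_eq_0_proj_point[of "Xs ! i" _ M] that
    by (simp add: flag_pairs_def pt_def trace_col_times_row)
  let ?U = "UNIV - {0 :: 'a}"
  let ?f = "\<lambda>(i, c, d). (c *s x i, d *s \<xi> i)"
  have "bij_betw ?f (I \<times> ?U \<times> ?U) (flag_pairs M)"
    unfolding bij_betw_def
  proof (intro conjI equalityI subsetI)
    show "inj_on ?f (I \<times> ?U \<times> ?U)"
    proof (rule inj_onI)
      fix z z' assume "z \<in> I \<times> ?U \<times> ?U" "z' \<in> I \<times> ?U \<times> ?U" and zz: "?f z = ?f z'"
      then obtain i c d j c' d' where z: "z = (i, c, d)" "z' = (j, c', d')"
        and ij: "i \<in> I" "j \<in> I" and nz: "c \<noteq> 0" "d \<noteq> 0" "c' \<noteq> 0" "d' \<noteq> 0"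
        by (elim SigmaE) simp
      have e: "c *s x i = c' *s x j" "d *s \<xi> i = d' *s \<xi> j" using zz z by auto
      have l: "i < length Xs" "j < length Xs" using ij by (auto simp: I_def)
      have "pt (x i) (\<xi> i) = pt (x j) (\<xi> j)" using pt_scale nz e by metis
      then have "map proj_point Xs ! i = map proj_point Xs ! j" using p(1) l by simp
      then have "i = j"
        using rep l unfolding representatives_def by (simp add: nth_eq_iff_index_eq del: nth_map)
      with e p(2,3)[OF l(1)] show "z = z'" using z by simp
    qed
  next
    fix z assume "z \<in> ?f ` (I \<times> ?U \<times> ?U)"
    then obtain i c d where z: "z = (c *s x i, d *s \<xi> i)" "i \<in> I" "c \<noteq> 0" "d \<noteq> 0" by auto
    then have "proj_point (Xs ! i) = pt (c *s x i) (d *s \<xi> i)"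
      using p(1)[of i] by (simp add: pt_scale I_def)
    from pair[OF this] show "z \<in> flag_pairs M"
      using z p(4)[of i] by (simp add: I_def row_times_col_scale_left row_times_col_scale_right)
  next
    fix z assume z: "z \<in> flag_pairs M"
    obtain y \<eta> where yz: "z = (y, \<eta>)" by fastforce
    have y: "y \<noteq> 0" "\<eta> \<noteq> 0" "row_times_col \<eta> y = 0"
      using z unfolding yz flag_pairs_def by auto
    then have "pt y \<eta> \<in> set (map proj_point Xs)"
      using rep unfolding representatives_def Lambda_def pt_def by blast
    then obtain i where i: "i < length Xs" "proj_point (Xs ! i) = pt y \<eta>"
      by (auto simp: in_set_conv_nth)
    with z have "i \<in> I" using pair yz by (simp add: I_def)
    have "pt y \<eta> = pt (x i) (\<xi> i)" using i p(1) by simp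
    then obtain k where "\<forall>a b. col_times_row (twist \<sigma> y) \<eta> $ a $ b =
        k * col_times_row (twist \<sigma> (x i)) (\<xi> i) $ a $ b"
      unfolding pt_def by (rule proj_point_eq_imp_multiple)
    then obtain c d where cd: "twist \<sigma> y = c *s twist \<sigma> (x i)" "\<eta> = d *s \<xi> i"
      by (rule col_times_row_eq_multiple) (use y in auto)
    \<comment> \<open>Removing the twist conjugates the scalar, hence \<open>\<sigma> c\<close> in
      the preimage below.\<close>
    then have "y = \<sigma> c *s x i" by (simp add: twist_eq_iff twist_scale)
    with cd y yz \<open>i \<in> I\<close> show "z \<in> ?f ` (I \<times> ?U \<times> ?U)"
      by (intro image_eqI[of _ _ "(i, \<sigma> c, d)"]) auto
  qed
  then have "card (I \<times> ?U \<times> ?U) = card (flag_pairs M)" by (rule bij_betw_same_card)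
  moreover have "hamming_weight (codeword Xs M) = card I"
    unfolding hamming_weight_def codeword_def I_def by (rule arg_cong[of _ _ card]) auto
  ultimately show ?thesis
    by (simp add: card_cartesian_product card_Diff_singleton power2_eq_square)
qed

lemma weight_le_iff:
  fixes M M' :: "'a ^ 3 ^ 3"
  assumes rep: "representatives Xs (Lambda \<sigma>)"
  shows "hamming_weight (codeword Xs M) \<le> hamming_weight (codeword Xs M') \<longleftrightarrow>
    card (eigenrows \<sigma> M') \<le> card (eigenrows \<sigma> M)"
proof -
  have q: "CARD('a) - 1 > 0" using one_lt_card_field[where 'a='a] by simp
  \<comment> \<open>Truncated subtraction from q^3 reverses the order faithfully only below
    q^3.\<close>
  have E: "card (eigenrows \<sigma> N) \<le> CARD('a) ^ 3" for N :: "'a ^ 3 ^ 3"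
    using card_mono[of UNIV "eigenrows \<sigma> N"] by simp
  have "hamming_weight (codeword Xs M) \<le> hamming_weight (codeword Xs M') \<longleftrightarrow>
      card (flag_pairs M) \<le> card (flag_pairs M')"
    using q by (simp flip: hamming_weight_codeword[OF rep])
  also have "\<dots> \<longleftrightarrow> CARD('a) ^ 3 - card (eigenrows \<sigma> M) \<le> CARD('a) ^ 3 - card (eigenrows \<sigma> M')"
    using q by (simp add: card_flag_pairs)
  also have "\<dots> \<longleftrightarrow> card (eigenrows \<sigma> M') \<le> card (eigenrows \<sigma> M)"
    using E[of M] E[of M'] by linarith
  finally show ?thesis .
qed

text \<open>A nonzero \<open>M\<close> has at most as many eigenrows as the identity, hence not all
  rows, and so some flag gives a nonzero entry. Competing nonzero codewords thus correspond to
  nonzero matrices.\<close>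

lemma codeword_nonzero_iff:
  fixes M :: "'a ^ 3 ^ 3"
  assumes rep: "representatives Xs (Lambda \<sigma>)"
  shows "(\<exists>a\<in>set (codeword Xs M). a \<noteq> 0) \<longleftrightarrow> M \<noteq> 0"
proof
  assume "\<exists>a\<in>set (codeword Xs M). a \<noteq> 0"
  then show "M \<noteq> 0" by (auto simp: codeword_def trace_def matrix_matrix_mult_def)
next
  assume "M \<noteq> 0"
  then have "card (eigenrows \<sigma> M) \<le> card (eigenrows \<sigma> (mat 1 :: 'a ^ 3 ^ 3))"
    using card_eigenrows_less[of M] card_eigenrows_equal_norm_basis[of M] by fastforce
  also have "\<dots> < CARD('a ^ 3)"
    using eigenrows_one_neq_UNIV by (intro psubset_card_mono) auto
  finally have "card (flag_pairs M) > 0"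
    using one_lt_card_field[where 'a='a] by (simp add: card_flag_pairs)
  then have "hamming_weight (codeword Xs M) > 0"
    using hamming_weight_codeword[OF rep, of M] by (metis bot_nat_0.not_eq_extremum mult_0)
  then obtain i where "i < length (codeword Xs M)" "codeword Xs M ! i \<noteq> 0"
    unfolding hamming_weight_def by (auto simp: card_gt_0_iff)
  then show "\<exists>a\<in>set (codeword Xs M). a \<noteq> 0" by (meson nth_mem)
qed

text \<open>The identity serves as the competitor: no nonzero matrix has more eigenrows, and a
  matrix without an equal-norm basis has strictly fewer.\<close>

lemma minimum_weight_iff_equal_norm_basis:
  fixes M :: "'a ^ 3 ^ 3"
  assumes rep: "representatives Xs (Lambda \<sigma>)" and "M \<noteq> 0"
  shows "minimum_weight_codeword (code Xs) (codeword Xs M) \<longleftrightarrow> equal_norm_basis M"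
proof -
  have "minimum_weight_codeword (code Xs) (codeword Xs M) \<longleftrightarrow>
      (\<forall>M' :: 'a ^ 3 ^ 3. M' \<noteq> 0 \<longrightarrow> card (eigenrows \<sigma> M') \<le> card (eigenrows \<sigma> M))"
    unfolding minimum_weight_codeword_def code_def
    using \<open>M \<noteq> 0\<close> by (simp add: codeword_nonzero_iff[OF rep] weight_le_iff[OF rep])
  also have "\<dots> \<longleftrightarrow> equal_norm_basis M"
  proof
    assume "\<forall>M' :: 'a ^ 3 ^ 3. M' \<noteq> 0 \<longrightarrow> card (eigenrows \<sigma> M') \<le> card (eigenrows \<sigma> M)"
    moreover have "mat 1 \<noteq> (0 :: 'a ^ 3 ^ 3)" by (simp add: vec_eq_iff mat_def)
    ultimately have "card (eigenrows \<sigma> (mat 1 :: 'a ^ 3 ^ 3)) \<le> card (eigenrows \<sigma> M)" by blast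
    then show "equal_norm_basis M" using card_eigenrows_less[OF \<open>M \<noteq> 0\<close>] by linarith
  next
    assume "equal_norm_basis M"
    show "\<forall>M' :: 'a ^ 3 ^ 3. M' \<noteq> 0 \<longrightarrow> card (eigenrows \<sigma> M') \<le> card (eigenrows \<sigma> M)"
      using card_eigenrows_less card_eigenrows_equal_norm_basis \<open>equal_norm_basis M\<close>
      by (metis less_imp_le order_refl)
  qed
  finally show ?thesis .
qed

end

theorem theorem3p17:
  fixes s :: nat
    and \<sigma> :: "'a::{field, finite} \<Rightarrow> 'a"
    and Xs :: "('a ^ 3 ^ 3) list"
    and M :: "'a ^ 3 ^ 3"
  assumes "primepow s"
    and "CARD('a) = s ^ 2"
    and "field_automorphism \<sigma>"
    and "\<sigma> \<circ> \<sigma> = id"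
    and "\<sigma> \<noteq> id"
    and "representatives Xs (Lambda \<sigma>)"
    and "M \<noteq> 0"
  shows "minimum_weight_codeword (code Xs) (codeword Xs M) \<longleftrightarrow>
    (\<exists>\<xi>1 \<xi>2 \<xi>3 \<alpha> \<beta> \<gamma>.
       distinct [\<xi>1, \<xi>2, \<xi>3] \<and> vec.independent {\<xi>1, \<xi>2, \<xi>3} \<and>
       \<alpha> \<noteq> 0 \<and> \<beta> \<noteq> 0 \<and> \<gamma> \<noteq> 0 \<and>
       \<xi>1 v* M = \<alpha> *s twist \<sigma> \<xi>1 \<and>
       \<xi>2 v* M = \<beta> *s twist \<sigma> \<xi>2 \<and>
       \<xi>3 v* M = \<gamma> *s twist \<sigma> \<xi>3 \<and>
       \<alpha> ^ (s + 1) = \<beta> ^ (s + 1) \<and> \<beta> ^ (s + 1) = \<gamma> ^ (s + 1))"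
proof -
  interpret field_involution \<sigma> by unfold_locales (fact assms)+
  have "a ^ (s + 1) = a * \<sigma> a" for a
    by (simp add: sigma_eq_power[OF assms(1,2)])
  then show ?thesis
    unfolding minimum_weight_iff_equal_norm_basis[OF assms(6,7)] equal_norm_basis_def indep3_iff_independent
    by (simp only: conj_assoc)
qed

end
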